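(* For all positive integers $n,d \ge 2$ there exists a collection $\mathcal{A} \subset \mathcal{P}([n]^d)$ with $|\mathcal{A}| = |\mathcal{P}([n]^d)|/2$ such that there is no pair $(A,B) \in \mathcal{A} \times \mathcal{A}$ satisfying $A \,\Delta\, B = I^d$ for some non-empty interval $I \subset [n]$.
   Context: $[n]=\{1,\dots,n\}$; for integers $a \le b$, $[a,b]=\{a,a+1,\dots,b\}$ is called an interval. $\mathcal{P}(X)$ denotes the power set of $X$, $A\,\Delta\, B$ the symmetric difference, and $I^d = I\times\dots\times I \subset [n]^d$ ($d$ factors). *)

theory Defs
  imports Complex_Main "HOL-Library.FuncSet"
begin

text \<open>
  The \<open>d\<close>-fold Cartesian power \<open>S \<times> \<dots> \<times> S\<close>. Since \<open>d\<close> is a variable, a \<open>d\<close>-tuple is an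
  extensional function on the index set \<open>{1..d}\<close>.
\<close>
definition cart_power :: "'a set \<Rightarrow> nat \<Rightarrow> (nat \<Rightarrow> 'a) set" where
  "cart_power S d = ({1..d} \<rightarrow>\<^sub>E S)"

text \<open>
  Endpoints are natural numbers: the intervals considered are subsets of \<open>{1..n}\<close>, so
  negative endpoints cannot occur.
\<close>
definition interval :: "nat set \<Rightarrow> bool" where
  "interval I \<longleftrightarrow> (\<exists>a b. a \<le> b \<and> I = {a..b})"

end

theory Submission
  imports Defs
begin

text \<open>
  It suffices to find a set \<open>T\<close> of points meeting every \<open>I\<^sup>d\<close> in an odd number of points: the sets
  \<open>A\<close> with \<open>card (A \<inter> T)\<close> even then form the desired collection, because \<open>sym_diff A B = I\<^sup>d\<close>
  forces \<open>card (A \<inter> T)\<close> and \<open>card (B \<inter> T)\<close> to have different parities. Such a \<open>T\<close> consists of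
  all points \<open>(x, x, \<dots>, x)\<close> and \<open>(x, x + 1, \<dots>, x + 1)\<close>: an interval of length \<open>k\<close> contributes
  \<open>k\<close> points of the first kind and \<open>k - 1\<close> of the second.
\<close>

text \<open>The sum \<open>card A + card B\<close> counts \<open>A \<inter> B\<close> twice and so
  exceeds the cardinality of the symmetric difference by an even number.\<close>

lemma even_card_sym_diff_iff:
  assumes "finite A" "finite B"
  shows "even (card (sym_diff A B)) \<longleftrightarrow> (even (card A) \<longleftrightarrow> even (card B))"
proof -
  have "card (sym_diff A B) = card (A - B) + card (B - A)"
    using assms by (intro card_Un_disjoint) auto
  moreover have "card A = card (A \<inter> B) + card (A - B)"
    using assms by (metis card_Diff_subset_Int card_mono finite_Int inf_le1 le_add_diff_inverse)
  moreover have "card B = card (A \<inter> B) + card (B - A)"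
    using assms by (metis card_Diff_subset_Int card_mono finite_Int inf_le1 le_add_diff_inverse inf_commute)
  ultimately show ?thesis by auto
qed

text \<open>Toggling the point \<open>p\<close> of \<open>T\<close> changes
  \<open>card (A \<inter> T)\<close> by one; being an involution, it pairs the even sets with the
  odd ones.\<close>

lemma card_even_intersection_half:
  assumes "finite S" "p \<in> S" "p \<in> T"
  shows "2 * card {A \<in> Pow S. even (card (A \<inter> T))} = card (Pow S)"
proof -
  let ?E = "{A \<in> Pow S. even (card (A \<inter> T))}" and ?O = "{A \<in> Pow S. odd (card (A \<inter> T))}"
  let ?f = "\<lambda>A. sym_diff A {p}"
  have flip: "even (card (?f A \<inter> T)) \<longleftrightarrow> odd (card (A \<inter> T))" if "A \<subseteq> S" for A
  proof -
    have "?f A \<inter> T = sym_diff (A \<inter> T) {p}" using assms by auto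
    moreover have "finite (A \<inter> T)" using that assms finite_subset by blast
    ultimately show ?thesis using even_card_sym_diff_iff[of "A \<inter> T" "{p}"] by simp
  qed
  have "bij_betw ?f ?E ?O"
  proof (rule bij_betw_byWitness[where f' = ?f])
    show "?f ` ?E \<subseteq> ?O" "?f ` ?O \<subseteq> ?E"
      using flip assms(2) by auto
  qed auto
  then have "card ?E = card ?O" by (rule bij_betw_same_card)
  moreover have "card (?E \<union> ?O) = card ?E + card ?O"
    using assms by (intro card_Un_disjoint) auto
  moreover have "?E \<union> ?O = Pow S" by auto
  ultimately show ?thesis by simp
qed

definition diag_point :: "nat \<Rightarrow> nat \<Rightarrow> nat \<Rightarrow> nat" where
  "diag_point d x = (\<lambda>i\<in>{1..d}. x)"

definition shifted_point :: "nat \<Rightarrow> nat \<Rightarrow> nat \<Rightarrow> nat" where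
  "shifted_point d x = (\<lambda>i\<in>{1..d}. if i = 1 then x else Suc x)"

lemma diag_point_in_cart_power_iff:
  assumes "d \<ge> 1"
  shows "diag_point d x \<in> cart_power I d \<longleftrightarrow> x \<in> I"
  using assms by (auto simp: diag_point_def cart_power_def PiE_iff)

text \<open>Coordinates 1 and 2 already carry both values \<open>x\<close> and \<open>Suc x\<close>;
  the second exists because \<open>d \<ge> 2\<close>.\<close>

lemma shifted_point_in_cart_power_iff:
  assumes "d \<ge> 2"
  shows "shifted_point d x \<in> cart_power I d \<longleftrightarrow> x \<in> I \<and> Suc x \<in> I"
proof
  assume "shifted_point d x \<in> cart_power I d"
  then have "shifted_point d x i \<in> I" if "i \<in> {1..d}" for i
    using that by (auto simp: cart_power_def)
  from this[of 1] this[of 2] show "x \<in> I \<and> Suc x \<in> I"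
    using assms by (simp add: shifted_point_def)
qed (auto simp: shifted_point_def cart_power_def)

lemma inj_diag_point:
  assumes "d \<ge> 1"
  shows "inj (diag_point d)"
  by (rule inj_on_inverseI[where g = "\<lambda>f. f 1"]) (use assms in \<open>simp add: diag_point_def\<close>)

lemma inj_shifted_point:
  assumes "d \<ge> 1"
  shows "inj (shifted_point d)"
  by (rule inj_on_inverseI[where g = "\<lambda>f. f 1"]) (use assms in \<open>simp add: shifted_point_def\<close>)

text \<open>Coordinates 1 and 2 agree in a diagonal point and differ in a shifted one.\<close>

lemma diag_point_neq_shifted_point:
  assumes "d \<ge> 2"
  shows "diag_point d x \<noteq> shifted_point d y"
proof
  assume "diag_point d x = shifted_point d y"
  from fun_cong[OF this, of 1] fun_cong[OF this, of 2] show False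
    using assms by (simp add: diag_point_def shifted_point_def)
qed

lemma odd_card_cart_power_interval:
  assumes "d \<ge> 2" "interval I"
  shows "odd (card (cart_power I d \<inter> (range (diag_point d) \<union> range (shifted_point d))))"
proof -
  obtain a b where ab: "a \<le> b" "I = {a..b}"
    using assms by (auto simp: interval_def)
  \<comment> \<open>Both \<open>x\<close> and \<open>Suc x\<close> lie in \<open>{a..b}\<close>
    exactly when \<open>a \<le> x < b\<close>, hence the half-open range.\<close>
  have "cart_power I d \<inter> (range (diag_point d) \<union> range (shifted_point d))
      = diag_point d ` {a..b} \<union> shifted_point d ` {a..<b}"
    using assms ab by (auto simp: diag_point_in_cart_power_iff shifted_point_in_cart_power_iff)
  moreover have "card (diag_point d ` {a..b} \<union> shifted_point d ` {a..<b})
      = card (diag_point d ` {a..b}) + card (shifted_point d ` {a..<b})"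
    using assms by (intro card_Un_disjoint) (auto simp: diag_point_neq_shifted_point)
  moreover have "card (diag_point d ` {a..b}) = Suc b - a"
    using assms by (simp add: card_image inj_on_subset[OF inj_diag_point])
  moreover have "card (shifted_point d ` {a..<b}) = b - a"
    using assms by (simp add: card_image inj_on_subset[OF inj_shifted_point])
  \<comment> \<open>As \<open>a \<le> b\<close>, no subtraction truncates and the total is
    \<open>2 * (b - a) + 1\<close>.\<close>
  ultimately show ?thesis using ab by (simp add: Suc_diff_le)
qed

theorem theorem2p1:
  fixes n d :: nat
  assumes "n \<ge> 2" and "d \<ge> 2"
  shows "\<exists>\<A> \<subseteq> Pow (cart_power {1..n} d).
           real (card \<A>) = real (card (Pow (cart_power {1..n} d))) / 2 \<and>
           \<not> (\<exists>(A, B) \<in> \<A> \<times> \<A>.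
                \<exists>I. interval I \<and> I \<noteq> {} \<and> I \<subseteq> {1..n} \<and> sym_diff A B = cart_power I d)"
proof -
  let ?S = "cart_power {1..n} d"
  let ?T = "range (diag_point d) \<union> range (shifted_point d)"
  let ?\<A> = "{A \<in> Pow ?S. even (card (A \<inter> ?T))}"
  have fin: "finite ?S" by (simp add: cart_power_def finite_PiE)
  \<comment> \<open>The halving lemma needs a point of \<open>?T\<close> inside \<open>?S\<close> to
    toggle; the all-ones point serves.\<close>
  have "diag_point d 1 \<in> ?S" using assms by (simp add: diag_point_in_cart_power_iff)
  then have "2 * card ?\<A> = card (Pow ?S)"
    using fin by (intro card_even_intersection_half) auto
  then have "real (card ?\<A>) = real (card (Pow ?S)) / 2" by linarith
  moreover have "sym_diff A B \<noteq> cart_power I d"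
    if "A \<in> ?\<A>" "B \<in> ?\<A>" "interval I" for A B I
  proof
    assume "sym_diff A B = cart_power I d"
    then have "cart_power I d \<inter> ?T = sym_diff (A \<inter> ?T) (B \<inter> ?T)" by blast
    \<comment> \<open>\<open>?T\<close> itself is infinite; finiteness comes from \<open>A\<close>
      and \<open>B\<close> being subsets of \<open>?S\<close>.\<close>
    moreover have "finite (A \<inter> ?T)" "finite (B \<inter> ?T)"
      using that fin finite_subset by blast+
    ultimately have "even (card (cart_power I d \<inter> ?T))"
      using that even_card_sym_diff_iff[of "A \<inter> ?T" "B \<inter> ?T"] by simp
    then show False using odd_card_cart_power_interval assms(2) that(3) by blast
  qed
  ultimately show ?thesis by (intro exI[of _ ?\<A>]) blast
qed

end
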